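(* Let $\mathbf{A}\in\mathbb{R}^{K\times K}$ be symmetric, with hemiplex Cholesky factorization $\mathbf{A}=\mathbf{L}\mathbf{L}^*$ and signs $d_1,\dots,d_K\in\{-1,0,1\}$ as constructed in the context, let $S=\{i: d_i=0\}$ and let $i_p$ denote the $p$th element of $S$ (in increasing order). Let $\mathbf{b}\in\mathbb{R}^K$. Let $\tilde{\mathbf{y}}$ be the solution of $\mathbf{L}\tilde{\mathbf{y}}=\mathbf{b}$, and $\mathbf{Y}$ the $K\times|S|$ pure-hemi matrix, obtained by the forward-substitutions described in the context; $\mathbf{Y}$ satisfies $\mathbf{L}\mathbf{Y}=0$ and $(Y_{i_p q})_\mu=\delta_{pq}$. Let $\tilde{\mathbf{x}}\in\mathbb{R}^K$ and $\mathbf{X}\in\mathbb{R}^{K\times|S|}$ be obtained from $\tilde{\mathbf{y}}$ and $\mathbf{Y}$, respectively, by solving only the $\mu$-component of the backward-substitution equations, as described in the context. Then, up to a possible correction $\mathbf{b}\to\mathbf{b}+\Delta\mathbf{b}$ restricted to the indices in $S$, the solution of $\mathbf{A}\mathbf{x}=\mathbf{b}$ may be expressed as $\mathbf{x}=\tilde{\mathbf{x}}+\mathbf{X}\boldsymbol{\alpha}$ with $\boldsymbol{\alpha}\in\mathbb{R}^{|S|}$. That is: there exists $\Delta\mathbf{b}\in\mathbb{R}^K$ with $(\Delta\mathbf{b})_i=0$ for all $i\notin S$ (which may be taken to be $0$ if $\mathbf{A}\mathbf{x}=\mathbf{b}$ is solvable) such that $\mathbf{A}\mathbf{x}=\mathbf{b}+\Delta\mathbf{b}$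 is solvable and every solution $\mathbf{x}\in\mathbb{R}^K$ of it has the form $\mathbf{x}=\tilde{\mathbf{x}}+\mathbf{X}\boldsymbol{\alpha}$ for some $\boldsymbol{\alpha}\in\mathbb{R}^{|S|}$.
   Context: Hemiplex numbers. $\mathbb{J}$ is the real vector space of $z=a+m\mu+n\nu$ ($a,m,n\in\mathbb{R}$) with the $\mathbb{R}$-bilinear commutative (non-associative) multiplication with unit $1$ determined by $\mu^2=\nu^2=0$, $\mu\nu=\nu\mu=-\tfrac12$. Write $(z)_\mu=m$, $(z)_\nu=n$; $z$ is pure-hemi if $a=0$. Conjugation: $\bar z=a-m\mu-n\nu$; $|z|^2=z\bar z=a^2+mn\in\mathbb{R}$. Symmetric division of $c\in\mathbb{R}$ by $z$ with $|z|^2\ne0$ is $c/z=c\,\bar z/|z|^2$. $\mathbf{L}^*$ is the conjugate transpose. Matrix products over $\mathbb{J}$ are $(\mathbf{B}\mathbf{C})_{ik}=\sum_j B_{ij}C_{jk}$. Factorization. Put $\mathbf{A}^{(1)}=\mathbf{A}$. For $j=1,\dots,K$, given the real symmetric matrix $\mathbf{A}^{(j)}$ with rows and columns indexed by $j,\dots,K$, set $d_j=\mathrm{sgn}(A^{(j)}_{jj})\in\{-1,0,1\}$; $\lambda_j=1$ if $A^{(j)}_{jj}=0$ and $\lambda_j=\sqrt{A^{(j)}_{jj}/d_j}$ otherwise; $L_{jj}=\lambda_j(\mu+d_j\nu)$; for $i>j$, $L_{ij}=\ell_{ij}(d_j\mu+\nu)$ with $\ell_{ij}=\dfrac{2A^{(j)}_{ij}}{\lambda_j(1+d_j^2)}$;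 for $i<j$, $L_{ij}=0$; and $A^{(j+1)}_{ik}=A^{(j)}_{ik}-L_{ij}\overline{L_{kj}}$ for $i,k>j$ (a real number). Then $\mathbf{A}=\mathbf{L}\mathbf{L}^*$. Forward-substitution. $\tilde{\mathbf{y}}$ is defined recursively for $i=1,\dots,K$ by $g_i=b_i-\sum_{j<i}L_{ij}\tilde y_j$ (real), $\tilde y_i=g_i/L_{ii}$ (symmetric division) if $i\notin S$, and $\tilde y_i=-2g_i\nu$ if $i\in S$. Column $q$ of $\mathbf{Y}$ ($1\le q\le|S|$) is defined by $Y_{iq}=0$ for $i<i_q$, $Y_{i_q q}=\mu$, and recursively for $i>i_q$ by $g_{iq}=-\sum_{j<i}L_{ij}Y_{jq}$, $Y_{iq}=g_{iq}/L_{ii}$ (symmetric division) if $i\notin S$, and $Y_{iq}=-2g_{iq}\nu$ if $i\in S$. Backward-substitution by the $\mu$-component. From a pure-hemi vector $\mathbf{y}$ one obtains a real vector $\mathbf{x}$ by solving, for $i=K,K-1,\dots,1$, the equation $(\overline{L_{ii}})_\mu\,x_i=(y_i)_\mu-\sum_{j>i}(\overline{L_{ji}})_\mu\,x_j$. Applied to $\tilde{\mathbf{y}}$ this gives $\tilde{\mathbf{x}}$; applied to each column of $\mathbf{Y}$ it gives the corresponding column of $\mathbf{X}$. *)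

theory Defs
  imports Complex_Main "Jordan_Normal_Form.Matrix"
begin

section \<open>Hemiplex numbers\<close>

datatype hemiplex = Hemiplex (hRe: real) (hmu: real) (hnu: real)

lemma hemiplex_eq_iff: "z = w \<longleftrightarrow> hRe z = hRe w \<and> hmu z = hmu w \<and> hnu z = hnu w"
  by (cases z; cases w) simp

instantiation hemiplex :: real_vector
begin

definition "0 = Hemiplex 0 0 0"
definition "z + w = Hemiplex (hRe z + hRe w) (hmu z + hmu w) (hnu z + hnu w)"
definition "- z = Hemiplex (- hRe z) (- hmu z) (- hnu z)"
definition "z - w = Hemiplex (hRe z - hRe w) (hmu z - hmu w) (hnu z - hnu w)"
definition "c *\<^sub>R z = Hemiplex (c * hRe z) (c * hmu z) (c * hnu z)"

instance
  by standard
    (simp_all add: hemiplex_eq_iff zero_hemiplex_def plus_hemiplex_def uminus_hemiplex_def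
      minus_hemiplex_def scaleR_hemiplex_def algebra_simps)

end

instantiation hemiplex :: "{one, times}"
begin

definition "1 = Hemiplex 1 0 0"

text \<open>The bilinear extension of the multiplication table of the basis; see
  \<open>hemiplex_mult_table\<close> and \<open>hemiplex_mult_bilinear\<close> below. The product is not
  associative, so the type is in no ring class.\<close>

definition
  "z * w = Hemiplex (hRe z * hRe w - (hmu z * hnu w + hnu z * hmu w) / 2)
     (hRe z * hmu w + hmu z * hRe w) (hRe z * hnu w + hnu z * hRe w)"

instance ..

end

lemmas hemiplex_defs = zero_hemiplex_def one_hemiplex_def plus_hemiplex_def uminus_hemiplex_def
  minus_hemiplex_def scaleR_hemiplex_def times_hemiplex_def

definition mu_unit :: hemiplex where "mu_unit = Hemiplex 0 1 0"

definition nu_unit :: hemiplex where "nu_unit = Hemiplex 0 0 1"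

definition hemi_of_real :: "real \<Rightarrow> hemiplex" where "hemi_of_real a = Hemiplex a 0 0"

lemma hemiplex_basis:
  "z = hemi_of_real (hRe z) + hmu z *\<^sub>R mu_unit + hnu z *\<^sub>R nu_unit"
  by (simp add: hemiplex_eq_iff hemiplex_defs mu_unit_def nu_unit_def hemi_of_real_def)

lemma hemiplex_mult_table:
  "mu_unit * mu_unit = 0" "nu_unit * nu_unit = 0"
  "mu_unit * nu_unit = hemi_of_real (- 1 / 2)" "nu_unit * mu_unit = hemi_of_real (- 1 / 2)"
  by (simp_all add: hemiplex_defs mu_unit_def nu_unit_def hemi_of_real_def)

lemma hemiplex_mult_bilinear:
  fixes x y z :: hemiplex
  shows "x * y = y * x" "1 * x = x" "(x + y) * z = x * z + y * z"
    "(c *\<^sub>R x) * y = c *\<^sub>R (x * y)"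
  by (simp_all add: hemiplex_defs hemiplex_eq_iff field_simps)

definition pure_hemi :: "hemiplex \<Rightarrow> bool" where "pure_hemi z \<longleftrightarrow> hRe z = 0"

definition hcnj :: "hemiplex \<Rightarrow> hemiplex" where
  "hcnj z = Hemiplex (hRe z) (- hmu z) (- hnu z)"

definition hnorm_sq :: "hemiplex \<Rightarrow> real" where "hnorm_sq z = (hRe z)\<^sup>2 + hmu z * hnu z"

lemma hemiplex_mult_cnj: "z * hcnj z = hemi_of_real (hnorm_sq z)"
  by (simp add: hemiplex_defs hcnj_def hnorm_sq_def hemi_of_real_def power2_eq_square)

text \<open>Symmetric division of a real number by \<open>z\<close>, meaningful only if \<open>hnorm_sq z \<noteq> 0\<close>.\<close>

definition sym_div :: "real \<Rightarrow> hemiplex \<Rightarrow> hemiplex" where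
  "sym_div c z = (c / hnorm_sq z) *\<^sub>R hcnj z"


section \<open>Matrices over the hemiplex numbers\<close>

text \<open>The products of the matrix library need a semiring of entries, which
  \<^typ>\<open>hemiplex\<close> is not.\<close>

definition hmat_mult :: "hemiplex mat \<Rightarrow> hemiplex mat \<Rightarrow> hemiplex mat" where
  "hmat_mult B C =
     mat (dim_row B) (dim_col C) (\<lambda>(i, k). \<Sum>j<dim_col B. B $$ (i, j) * C $$ (j, k))"

definition hmat_mult_vec :: "hemiplex mat \<Rightarrow> hemiplex vec \<Rightarrow> hemiplex vec" where
  "hmat_mult_vec B v = vec (dim_row B) (\<lambda>i. \<Sum>j<dim_col B. B $$ (i, j) * v $ j)"

definition hmat_adjoint :: "hemiplex mat \<Rightarrow> hemiplex mat" where
  "hmat_adjoint B = transpose_mat (map_mat hcnj B)"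


section \<open>Hemiplex Cholesky factorization\<close>

text \<open>Rows and columns are numbered from 0. The next three definitions describe one elimination
  step, in terms of the current matrix \<open>M\<close> and the current column \<open>j\<close>.\<close>

definition pivot_sign :: "real mat \<Rightarrow> nat \<Rightarrow> real" where
  "pivot_sign M j = sgn (M $$ (j, j))"

definition pivot_scale :: "real mat \<Rightarrow> nat \<Rightarrow> real" where
  "pivot_scale M j = (if M $$ (j, j) = 0 then 1 else sqrt (M $$ (j, j) / pivot_sign M j))"

definition chol_entry :: "real mat \<Rightarrow> nat \<Rightarrow> nat \<Rightarrow> hemiplex" where
  "chol_entry M i j =
     (if i = j then pivot_scale M j *\<^sub>R (mu_unit + pivot_sign M j *\<^sub>R nu_unit)
      else if j < i then
        (2 * M $$ (i, j) / (pivot_scale M j * (1 + (pivot_sign M j)\<^sup>2)))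
          *\<^sub>R (pivot_sign M j *\<^sub>R mu_unit + nu_unit)
      else 0)"

text \<open>\<open>chol_rest A j\<close> is the matrix left after \<open>j\<close> elimination steps. It is kept at full size, but
  only its rows and columns with index at least \<open>j\<close> are meaningful and used later.
  The subtracted products of two pure-hemi numbers are real, so that \<^const>\<open>hRe\<close> merely
  changes the type.\<close>

primrec chol_rest :: "real mat \<Rightarrow> nat \<Rightarrow> real mat" where
  "chol_rest A 0 = A"
| "chol_rest A (Suc j) = mat (dim_row A) (dim_col A)
     (\<lambda>(i, k). chol_rest A j $$ (i, k)
        - hRe (chol_entry (chol_rest A j) i j * hcnj (chol_entry (chol_rest A j) k j)))"

definition chol_sign :: "real mat \<Rightarrow> nat \<Rightarrow> real" where
  "chol_sign A j = pivot_sign (chol_rest A j) j"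

definition hemi_cholesky :: "real mat \<Rightarrow> hemiplex mat" where
  "hemi_cholesky A = mat (dim_row A) (dim_row A) (\<lambda>(i, j). chol_entry (chol_rest A j) i j)"

definition zero_pivots :: "real mat \<Rightarrow> nat set" where
  "zero_pivots A = {i. i < dim_row A \<and> chol_sign A i = 0}"

text \<open>The elements of a finite set in increasing order, numbered from 0.\<close>

definition nth_elem :: "nat set \<Rightarrow> nat \<Rightarrow> nat" where
  "nth_elem S p = sorted_list_of_set S ! p"


section \<open>Forward and backward substitution\<close>

text \<open>For a factor \<open>L\<close> as above, the arguments of \<^const>\<open>hRe\<close> in the two forward substitutions
  are real.\<close>

fun fwd_coord :: "hemiplex mat \<Rightarrow> nat set \<Rightarrow> real vec \<Rightarrow> nat \<Rightarrow> hemiplex" where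
  "fwd_coord L S b i =
     (let g = hRe (hemi_of_real (b $ i) - (\<Sum>j<i. L $$ (i, j) * fwd_coord L S b j))
      in if i \<in> S then (- 2 * g) *\<^sub>R nu_unit else sym_div g (L $$ (i, i)))"

definition fwd_subst :: "hemiplex mat \<Rightarrow> nat set \<Rightarrow> real vec \<Rightarrow> hemiplex vec" where
  "fwd_subst L S b = vec (dim_row L) (fwd_coord L S b)"

text \<open>The homogeneous solution that starts with \<^const>\<open>mu_unit\<close> at the index \<open>k \<in> S\<close>.\<close>

fun hom_coord :: "hemiplex mat \<Rightarrow> nat set \<Rightarrow> nat \<Rightarrow> nat \<Rightarrow> hemiplex" where
  "hom_coord L S k i =
     (if i < k then 0
      else if i = k then mu_unit
      else let g = hRe (- (\<Sum>j<i. L $$ (i, j) * hom_coord L S k j))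
        in if i \<in> S then (- 2 * g) *\<^sub>R nu_unit else sym_div g (L $$ (i, i)))"

definition hom_solutions :: "hemiplex mat \<Rightarrow> nat set \<Rightarrow> hemiplex mat" where
  "hom_solutions L S =
     mat (dim_row L) (card S) (\<lambda>(i, q). hom_coord L S (nth_elem S q) i)"

function back_coord :: "hemiplex mat \<Rightarrow> hemiplex vec \<Rightarrow> nat \<Rightarrow> real" where
  "back_coord L y i =
     (hmu (y $ i) - (\<Sum>j\<in>{i<..<dim_row L}. hmu (hcnj (L $$ (j, i))) * back_coord L y j))
       / hmu (hcnj (L $$ (i, i)))"
  by pat_completeness auto
termination
  by (relation "measure (\<lambda>(L, y, i). dim_row L - i)") auto

declare fwd_coord.simps [simp del] hom_coord.simps [simp del] back_coord.simps [simp del]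

definition back_subst :: "hemiplex mat \<Rightarrow> hemiplex vec \<Rightarrow> real vec" where
  "back_subst L y = vec (dim_row L) (back_coord L y)"

definition back_subst_cols :: "hemiplex mat \<Rightarrow> hemiplex mat \<Rightarrow> real mat" where
  "back_subst_cols L Y =
     mat (dim_row L) (dim_col Y) (\<lambda>(i, q). back_subst L (col Y q) $ i)"

text \<open>The division in \<^const>\<open>back_coord\<close> is always by a nonzero number, so that the
  \<open>\<mu>\<close>-components of the backward-substitution equations do hold.\<close>

lemma hmu_cnj_chol_diag_neq_0:
  assumes "i < dim_row A"
  shows "hmu (hcnj (hemi_cholesky A $$ (i, i))) \<noteq> 0"
  using assms
  by (auto simp: hemi_cholesky_def chol_entry_def pivot_scale_def pivot_sign_def hcnj_def
      hemiplex_defs mu_unit_def nu_unit_def sgn_if)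

lemma back_subst_equation:
  assumes "L = hemi_cholesky A" "i < dim_row A"
  shows "hmu (hcnj (L $$ (i, i))) * back_subst L y $ i =
     hmu (y $ i) - (\<Sum>j\<in>{i<..<dim_row A}. hmu (hcnj (L $$ (j, i))) * back_subst L y $ j)"
proof -
  have d: "dim_row L = dim_row A"
    using assms(1) by (simp add: hemi_cholesky_def)
  have "back_subst L y $ i = back_coord L y i"
    using assms(2) d by (simp add: back_subst_def)
  moreover have "(\<Sum>j\<in>{i<..<dim_row A}. hmu (hcnj (L $$ (j, i))) * back_subst L y $ j)
      = (\<Sum>j\<in>{i<..<dim_row A}. hmu (hcnj (L $$ (j, i))) * back_coord L y j)"
    by (rule sum.cong) (auto simp: back_subst_def d)
  ultimately show ?thesis
    using hmu_cnj_chol_diag_neq_0[OF assms(2)] assms(1) d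
    by (subst (asm) back_coord.simps) simp
qed

end

theory Submission
  imports Defs
begin

text \<open>Split \<open>L = M \<mu> + N \<nu>\<close> with real lower triangular \<open>M\<close>, \<open>N\<close>. A column \<open>j \<notin> S\<close> of \<open>N\<close> is
  \<open>d\<^sub>j = \<plusminus>1\<close> times that of \<open>M\<close>, while a column \<open>j \<in> S\<close> of \<open>M\<close> is a unit vector. Hence, for real \<open>x\<close>,
  the vector \<open>z = L\<^sup>* x\<close> satisfies \<open>(z\<^sub>i)\<^sub>\<nu> = d\<^sub>i (z\<^sub>i)\<^sub>\<mu>\<close> for \<open>i \<notin> S\<close>, as the results of the forward
  substitutions do. Since \<open>\<nu>\<^sup>2 = 0\<close>, the \<open>\<nu>\<close>-components at indices in \<open>S\<close> only influence the entries
  of \<open>L z\<close> at those same indices. So if \<open>A x = L z\<close> agrees with \<open>b\<close> off \<open>S\<close>, then forward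
  elimination shows that the \<open>\<mu>\<close>-components of \<open>z\<close> and \<open>y + Y \<alpha>\<close> are equal, where \<open>\<alpha>\<close> lists the
  \<open>\<mu>\<close>-components of \<open>z\<close> on \<open>S\<close>; inverting \<open>M\<^sup>T\<close> gives \<open>x = xt + X \<alpha>\<close>. By the same
  observation \<open>A xt\<close> differs from \<open>b\<close> only on \<open>S\<close>, which provides the correction.\<close>

section \<open>Componentwise hemiplex arithmetic and triangular sums\<close>

lemma hemiplex_sel_simps [simp]:
  "hRe 0 = 0" "hmu 0 = 0" "hnu 0 = 0"
  "hRe (z + w) = hRe z + hRe w" "hmu (z + w) = hmu z + hmu w" "hnu (z + w) = hnu z + hnu w"
  "hRe (z - w) = hRe z - hRe w" "hmu (z - w) = hmu z - hmu w" "hnu (z - w) = hnu z - hnu w"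
  "hRe (- z) = - hRe z" "hmu (- z) = - hmu z" "hnu (- z) = - hnu z"
  "hRe (c *\<^sub>R z) = c * hRe z" "hmu (c *\<^sub>R z) = c * hmu z" "hnu (c *\<^sub>R z) = c * hnu z"
  "hmu (z * w) = hRe z * hmu w + hmu z * hRe w"
  "hnu (z * w) = hRe z * hnu w + hnu z * hRe w"
  "hRe (hcnj z) = hRe z" "hmu (hcnj z) = - hmu z" "hnu (hcnj z) = - hnu z"
  "hRe (hemi_of_real a) = a" "hmu (hemi_of_real a) = 0" "hnu (hemi_of_real a) = 0"
  "hRe mu_unit = 0" "hmu mu_unit = 1" "hnu mu_unit = 0"
  "hRe nu_unit = 0" "hmu nu_unit = 0" "hnu nu_unit = 1"
  by (simp_all add: hemiplex_defs hcnj_def hemi_of_real_def mu_unit_def nu_unit_def)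

lemma hRe_mult: "hRe (z * w) = hRe z * hRe w - (hmu z * hnu w + hnu z * hmu w) / 2"
  by (simp add: hemiplex_defs)

lemma hemiplex_mult_zero [simp]: "0 * z = (0 :: hemiplex)" "z * 0 = (0 :: hemiplex)"
  and hcnj_zero [simp]: "hcnj 0 = 0"
  by (simp_all add: hemiplex_eq_iff hRe_mult)

text \<open>As \<open>hemiplex\<close> is in no ring class, distributivity over sums, differences
  and real scalings is drawn from the theory of linear maps.\<close>

lemma linear_hRe_mult: "linear (\<lambda>w. hRe (z * w))"
  by (rule linearI) (simp_all add: hRe_mult algebra_simps add_divide_distrib)

lemmas hRe_mult_sum = linear_sum[OF linear_hRe_mult]
  and hRe_mult_diff = linear_diff[OF linear_hRe_mult]
  and hRe_mult_scaleR = linear_scale[OF linear_hRe_mult]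

lemma hRe_mult_hcnj_commute: "hRe (z * hcnj w) = hRe (w * hcnj z)"
  by (simp add: hRe_mult)

lemma hRe_sum [simp]: "hRe (\<Sum>i\<in>I. f i) = (\<Sum>i\<in>I. hRe (f i))"
  by (induction I rule: infinite_finite_induct) auto

lemma hmu_sum [simp]: "hmu (\<Sum>i\<in>I. f i) = (\<Sum>i\<in>I. hmu (f i))"
  by (induction I rule: infinite_finite_induct) auto

lemma hnu_sum [simp]: "hnu (\<Sum>i\<in>I. f i) = (\<Sum>i\<in>I. hnu (f i))"
  by (induction I rule: infinite_finite_induct) auto

lemma bij_betw_nth_elem: "finite S \<Longrightarrow> bij_betw (nth_elem S) {..<card S} S"
  unfolding nth_elem_def by (rule bij_betw_nth) auto

lemma sum_lower_triangular:
  assumes "i < (K::nat)" and "\<And>j. i < j \<Longrightarrow> j < K \<Longrightarrow> f j = (0::'a::comm_monoid_add)"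
  shows "(\<Sum>j<K. f j) = (\<Sum>j<i. f j) + f i"
proof -
  have "(\<Sum>j<K. f j) = (\<Sum>j<Suc i. f j)"
    using assms by (intro sum.mono_neutral_right) auto
  then show ?thesis by simp
qed

lemma sum_upper_triangular:
  assumes "i < (K::nat)" and "\<And>j. j < i \<Longrightarrow> f j = (0::'a::comm_monoid_add)"
  shows "(\<Sum>j<K. f j) = f i + (\<Sum>j\<in>{i<..<K}. f j)"
proof -
  have "(\<Sum>j<K. f j) = (\<Sum>j\<in>insert i {i<..<K}. f j)"
    using assms by (intro sum.mono_neutral_right) (auto simp: not_less_iff_gr_or_eq)
  then show ?thesis by simp
qed

section \<open>The factor \<open>L\<close> and the factorization\<close>

locale cholesky =
  fixes A :: "real mat" and K :: nat
  assumes carrier: "A \<in> carrier_mat K K" and symmetric: "transpose_mat A = A"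
begin

abbreviation "L \<equiv> hemi_cholesky A"
abbreviation "S \<equiv> zero_pivots A"
abbreviation "d \<equiv> chol_sign A"

text \<open>The relation shared by \<open>L\<^sup>* x\<close>, for real \<open>x\<close>, and the forward substitutions.\<close>

definition balanced :: "nat \<Rightarrow> hemiplex \<Rightarrow> bool" where
  "balanced i z \<longleftrightarrow> pure_hemi z \<and> (i \<notin> S \<longrightarrow> hnu z = d i * hmu z)"

lemma dims [simp]: "dim_row A = K" "dim_col A = K" "dim_row L = K" "dim_col L = K"
  using carrier by (auto simp: hemi_cholesky_def)

lemma finite_S [simp]: "finite S"
  by (simp add: zero_pivots_def)

lemma S_lt: "i \<in> S \<Longrightarrow> i < K"
  by (simp add: zero_pivots_def)

lemma mem_S: "i < K \<Longrightarrow> i \<in> S \<longleftrightarrow> d i = 0"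
  by (simp add: zero_pivots_def)

lemma L_entry: "i < K \<Longrightarrow> j < K \<Longrightarrow> L $$ (i, j) = chol_entry (chol_rest A j) i j"
  by (simp add: hemi_cholesky_def)

lemma chol_rest_symmetric:
  "i < K \<Longrightarrow> k < K \<Longrightarrow> chol_rest A m $$ (i, k) = chol_rest A m $$ (k, i)"
proof (induction m)
  case 0
  then have "transpose_mat A $$ (i, k) = A $$ (k, i)" by simp
  with symmetric show ?case by simp
next
  case (Suc m)
  then show ?case by (simp add: hRe_mult_hcnj_commute[of "chol_entry _ k _"])
qed

text \<open>Rows above the current one stay zero because \<open>chol_entry\<close> vanishes above
  the diagonal. In the current row, with pivot sign d, scale s and multiplier l, the product
  subtracted at the pivot is s^2 d, and to its right it is s l (1 + d^2) / 2; both are exactly the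
  entries present, also for d = 0.\<close>

lemma chol_rest_eliminated:
  "i < K \<Longrightarrow> k < K \<Longrightarrow> i < m \<Longrightarrow> chol_rest A m $$ (i, k) = 0"
proof (induction m arbitrary: i k)
  case (Suc m)
  show ?case
  proof (cases "i < m")
    case True
    with Suc show ?thesis by (simp add: chol_entry_def)
  next
    case False
    with Suc.prems have [simp]: "i = m" by simp
    show ?thesis
    proof (cases "k < m")
      \<comment> \<open>By symmetry this entry lies in the row k eliminated earlier, and nothing is
        subtracted from it.\<close>
      case True
      then have "chol_rest A m $$ (m, k) = 0"
        using Suc.IH[of k m] chol_rest_symmetric[of m k m] Suc.prems by simp
      with True Suc.prems show ?thesis by (simp add: chol_entry_def)
    next
      case False
      with Suc.prems show ?thesis
        by (auto simp: chol_entry_def pivot_scale_def pivot_sign_def sgn_if hRe_mult field_simps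
            chol_rest_symmetric[of m k] power2_eq_square)
    qed
  qed
qed simp

lemma hRe_L [simp]: "i < K \<Longrightarrow> j < K \<Longrightarrow> hRe (L $$ (i, j)) = 0"
  by (simp add: L_entry chol_entry_def)

lemma L_upper: "i < j \<Longrightarrow> j < K \<Longrightarrow> L $$ (i, j) = 0"
  by (simp add: L_entry chol_entry_def)

lemma hmu_L_diag: "i < K \<Longrightarrow> hmu (L $$ (i, i)) \<noteq> 0"
  using hmu_cnj_chol_diag_neq_0[of i A] by simp

lemma hmu_L_diag_S: "i \<in> S \<Longrightarrow> hmu (L $$ (i, i)) = 1"
  by (auto simp: zero_pivots_def L_entry chol_entry_def pivot_scale_def chol_sign_def pivot_sign_def
      sgn_zero_iff)

lemma hmu_L_S: "j \<in> S \<Longrightarrow> i < K \<Longrightarrow> i \<noteq> j \<Longrightarrow> hmu (L $$ (i, j)) = 0"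
  by (auto simp: zero_pivots_def L_entry chol_entry_def chol_sign_def)

lemma hnu_L_diag: "i < K \<Longrightarrow> hnu (L $$ (i, i)) = d i * hmu (L $$ (i, i))"
  by (simp add: L_entry chol_entry_def chol_sign_def)

text \<open>Here d = 1 or d = -1, so d^2 = 1 and d \<mu> + \<nu> = d (\<mu> + d \<nu>): the entries
  below the diagonal have the same component ratio as the diagonal.\<close>

lemma hnu_L: "j \<notin> S \<Longrightarrow> i < K \<Longrightarrow> j < K \<Longrightarrow> hnu (L $$ (i, j)) = d j * hmu (L $$ (i, j))"
  by (auto simp: zero_pivots_def L_entry chol_entry_def chol_sign_def pivot_sign_def sgn_if
      split: if_splits)

lemma factorization: "map_mat hemi_of_real A = hmat_mult L (hmat_adjoint L)"
proof (rule eq_matI)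
  fix i k assume "i < dim_row (hmat_mult L (hmat_adjoint L))"
    "k < dim_col (hmat_mult L (hmat_adjoint L))"
  then have ik: "i < K" "k < K"
    by (simp_all add: hmat_mult_def hmat_adjoint_def)
  \<comment> \<open>The elimination steps telescope; at m = K nothing remains of A.\<close>
  have rest: "A $$ (i, k) =
      chol_rest A m $$ (i, k) + (\<Sum>j<m. hRe (L $$ (i, j) * hcnj (L $$ (k, j))))" if "m \<le> K" for m
    using that
  proof (induction m)
    case (Suc m)
    then show ?case using ik L_entry[of i m] L_entry[of k m]
      by simp
  qed simp
  have "A $$ (i, k) = (\<Sum>j<K. hRe (L $$ (i, j) * hcnj (L $$ (k, j))))"
    using rest[of K] chol_rest_eliminated[of i k K] ik by simp
  then show "map_mat hemi_of_real A $$ (i, k) = hmat_mult L (hmat_adjoint L) $$ (i, k)"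
    using ik by (simp add: hmat_mult_def hmat_adjoint_def hemiplex_eq_iff)
qed (simp_all add: hmat_mult_def hmat_adjoint_def)

lemma hnorm_sq_L_diag: "i < K \<Longrightarrow> i \<notin> S \<Longrightarrow> hnorm_sq (L $$ (i, i)) \<noteq> 0"
  using hmu_L_diag[of i] by (simp add: hnorm_sq_def hnu_L_diag mem_S)

section \<open>Forward substitution\<close>

definition fwd_step :: "nat \<Rightarrow> real \<Rightarrow> hemiplex" where
  "fwd_step i g = (if i \<in> S then (- 2 * g) *\<^sub>R nu_unit else sym_div g (L $$ (i, i)))"

text \<open>Off \<open>S\<close> the result is a real multiple of the conjugate of
  \<open>L $$ (i, i)\<close>, and conjugation keeps the ratio of the components.\<close>

lemma balanced_fwd_step: "i < K \<Longrightarrow> balanced i (fwd_step i g)"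
  by (auto simp: balanced_def pure_hemi_def fwd_step_def sym_div_def hnu_L_diag)

text \<open>For i in \<open>S\<close> the diagonal entry is \<mu>, and \<mu> (-2 g \<nu>) = g. For
  other i this is z times its conjugate being the nonzero real |z|^2.\<close>

lemma L_diag_mult_fwd_step:
  assumes "i < K"
  shows "L $$ (i, i) * fwd_step i g = hemi_of_real g"
proof (cases "i \<in> S")
  case True
  then show ?thesis
    using assms by (simp add: fwd_step_def hemiplex_eq_iff hRe_mult hmu_L_diag_S)
next
  case False
  have "L $$ (i, i) * fwd_step i g = (g / hnorm_sq (L $$ (i, i))) *\<^sub>R (L $$ (i, i) * hcnj (L $$ (i, i)))"
    using False by (simp add: fwd_step_def sym_div_def hemiplex_eq_iff hRe_mult_scaleR)
  also have "\<dots> = hemi_of_real g"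
    using hnorm_sq_L_diag[OF assms False] by (simp add: hemiplex_mult_cnj hemiplex_eq_iff)
  finally show ?thesis .
qed

text \<open>Serves both substitutions, with c = \<open>b $ i\<close> and with c = 0. Purity makes
  the sum left of the diagonal real, so taking \<open>hRe\<close> in the recursion loses
  nothing.\<close>

lemma L_mult_fwd_step:
  assumes "i < K" and pure: "\<And>j. j < i \<Longrightarrow> pure_hemi (v j)"
    and v: "v i = fwd_step i (c - (\<Sum>j<i. hRe (L $$ (i, j) * v j)))"
  shows "(\<Sum>j<K. L $$ (i, j) * v j) = hemi_of_real c"
proof -
  have "(\<Sum>j<K. L $$ (i, j) * v j) = (\<Sum>j<i. L $$ (i, j) * v j) + L $$ (i, i) * v i"
    using assms(1) by (intro sum_lower_triangular) (auto simp: L_upper hemiplex_eq_iff)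
  also have "\<dots> = hemi_of_real c"
    unfolding v L_diag_mult_fwd_step[OF assms(1)]
    using assms(1) pure by (simp add: hemiplex_eq_iff pure_hemi_def)
  finally show ?thesis .
qed

lemma fwd_coord_eq:
  "fwd_coord L S b i = fwd_step i (b $ i - (\<Sum>j<i. hRe (L $$ (i, j) * fwd_coord L S b j)))"
  by (subst fwd_coord.simps) (simp add: fwd_step_def Let_def)

lemma balanced_fwd_coord: "i < K \<Longrightarrow> balanced i (fwd_coord L S b i)"
  by (subst fwd_coord_eq) (rule balanced_fwd_step)

lemma hmu_fwd_coord_S: "i \<in> S \<Longrightarrow> hmu (fwd_coord L S b i) = 0"
  by (subst fwd_coord_eq) (simp add: fwd_step_def)

lemma L_mult_fwd_coord:
  "i < K \<Longrightarrow> (\<Sum>j<K. L $$ (i, j) * fwd_coord L S b j) = hemi_of_real (b $ i)"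
  using balanced_fwd_coord by (intro L_mult_fwd_step fwd_coord_eq) (auto simp: balanced_def)

lemma hom_coord_eq:
  "k < i \<Longrightarrow> hom_coord L S k i = fwd_step i (0 - (\<Sum>j<i. hRe (L $$ (i, j) * hom_coord L S k j)))"
  by (subst hom_coord.simps) (simp add: fwd_step_def Let_def)

lemma hom_coord_less: "i < k \<Longrightarrow> hom_coord L S k i = 0"
  by (subst hom_coord.simps) simp

lemma hom_coord_same: "hom_coord L S k k = mu_unit"
  by (subst hom_coord.simps) simp

lemma balanced_hom_coord: "k \<in> S \<Longrightarrow> i < K \<Longrightarrow> balanced i (hom_coord L S k i)"
  by (cases i k rule: linorder_cases)
    (auto simp: hom_coord_less hom_coord_same hom_coord_eq[of k i] balanced_def pure_hemi_def
      balanced_fwd_step[unfolded balanced_def pure_hemi_def])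

lemma hmu_hom_coord_S: "i \<in> S \<Longrightarrow> hmu (hom_coord L S k i) = (if i = k then 1 else 0)"
  by (cases i k rule: linorder_cases)
    (auto simp: hom_coord_less hom_coord_same hom_coord_eq[of k i] fwd_step_def)

lemma L_mult_hom_coord:
  assumes "k \<in> S" "i < K"
  shows "(\<Sum>j<K. L $$ (i, j) * hom_coord L S k j) = 0"
proof (cases "k < i")
  case True
  with assms have "(\<Sum>j<K. L $$ (i, j) * hom_coord L S k j) = hemi_of_real 0"
    using balanced_hom_coord by (intro L_mult_fwd_step hom_coord_eq) (auto simp: balanced_def)
  then show ?thesis by (simp add: hemiplex_eq_iff)
next
  case False
  \<comment> \<open>In rows i \<le> k each term has a zero factor, except for i = j = k, where the
    product is \<mu>^2 = 0.\<close>
  have "L $$ (i, j) * hom_coord L S k j = 0" if "j < K" for j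
  proof (cases j k rule: linorder_cases)
    case equal
    then show ?thesis
      using False assms that mem_S[of k]
      by (cases "i = k") (auto simp: hemiplex_eq_iff hRe_mult hom_coord_same L_upper hnu_L_diag)
  next
    case greater
    then show ?thesis using False assms that by (simp add: hemiplex_eq_iff L_upper)
  qed (simp add: hom_coord_less hemiplex_eq_iff)
  then show ?thesis by simp
qed

section \<open>Uniqueness of \<mu>-components under forward elimination\<close>

lemma L_S_mult_nu:
  assumes "j \<in> S" "i < K" "i \<noteq> j" "hRe z = 0" "hmu z = 0"
  shows "hRe (L $$ (i, j) * z) = 0"
  \<comment> \<open>Off the diagonal, a column in \<open>S\<close> consists of multiples of \<nu>,
    and \<nu>^2 = 0.\<close>
  using assms S_lt[of j] by (simp add: hRe_mult hmu_L_S)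

lemma balanced_eq_zero:
  assumes "balanced i z" "hmu z = 0" "i \<notin> S"
  shows "z = 0"
  using assms by (simp add: balanced_def pure_hemi_def hemiplex_eq_iff)

text \<open>Forward elimination using only rows off \<open>S\<close>. In such a row, earlier terms
  with j in \<open>S\<close> vanish by \<open>L_S_mult_nu\<close>, although \<open>v j\<close> may
  retain a \<nu>-component; the other earlier \<open>v j\<close> are zero by induction and
  balance.\<close>

lemma hmu_eq_zero_if_L_mult_zero:
  assumes bal: "\<And>j. j < K \<Longrightarrow> balanced j (v j)" and muS: "\<And>j. j \<in> S \<Longrightarrow> hmu (v j) = 0"
    and Lv: "\<And>j. j < K \<Longrightarrow> j \<notin> S \<Longrightarrow> (\<Sum>k<K. hRe (L $$ (j, k) * v k)) = 0"
    and "i < K"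
  shows "hmu (v i) = 0"
  using \<open>i < K\<close>
proof (induction i rule: less_induct)
  case (less i)
  show ?case
  proof (cases "i \<in> S")
    case False
    have "hRe (L $$ (i, j) * v j) = 0" if "j < i" for j
    proof (cases "j \<in> S")
      case True
      then show ?thesis
        using that less.prems bal[of j] muS by (intro L_S_mult_nu) (auto simp: balanced_def pure_hemi_def)
    next
      case False
      then have "v j = 0"
        using that less by (intro balanced_eq_zero[of j] bal) auto
      then show ?thesis by simp
    qed
    moreover have "(\<Sum>k<K. hRe (L $$ (i, k) * v k)) =
        (\<Sum>k<i. hRe (L $$ (i, k) * v k)) + hRe (L $$ (i, i) * v i)"
      using less.prems by (intro sum_lower_triangular) (auto simp: L_upper)
    ultimately have "hRe (L $$ (i, i) * v i) = 0"
      using Lv[OF less.prems False] by simp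
    \<comment> \<open>For balanced \<open>v i\<close> the real part of the diagonal product is - d i
      times the product of the two \<mu>-components, and d i is nonzero off
      \<open>S\<close>.\<close>
    then show ?thesis
      using less.prems False bal[of i] hmu_L_diag[of i] mem_S[of i]
      by (simp add: hRe_mult hnu_L_diag balanced_def pure_hemi_def)
  qed (rule muS)
qed

section \<open>The coordinates of \<open>L^* x\<close> for real x, and backward substitution\<close>

definition adj_coord :: "real vec \<Rightarrow> nat \<Rightarrow> hemiplex" where
  "adj_coord x j = (\<Sum>k<K. x $ k *\<^sub>R hcnj (L $$ (k, j)))"

lemma balanced_adj_coord: "j < K \<Longrightarrow> balanced j (adj_coord x j)"
  by (auto simp: balanced_def pure_hemi_def adj_coord_def hnu_L sum_distrib_left algebra_simps
      intro!: sum.cong)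

text \<open>Despite non-associativity, A x = L (L^* x) holds, because x is real and the product is
  real bilinear.\<close>

lemma A_mult_eq:
  assumes "x \<in> carrier_vec K" "i < K"
  shows "(A *\<^sub>v x) $ i = (\<Sum>j<K. hRe (L $$ (i, j) * adj_coord x j))"
proof -
  have A: "A $$ (i, k) = (\<Sum>j<K. hRe (L $$ (i, j) * hcnj (L $$ (k, j))))" if "k < K" for k
  proof -
    have "hRe (map_mat hemi_of_real A $$ (i, k)) = A $$ (i, k)"
      using assms that by simp
    then show ?thesis
      using assms that by (simp add: factorization hmat_mult_def hmat_adjoint_def)
  qed
  have "(A *\<^sub>v x) $ i = (\<Sum>k<K. A $$ (i, k) * x $ k)"
    using assms by (simp add: scalar_prod_def atLeast0LessThan)
  also have "\<dots> = (\<Sum>k<K. \<Sum>j<K. x $ k * hRe (L $$ (i, j) * hcnj (L $$ (k, j))))"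
    by (rule sum.cong) (simp_all add: A sum_distrib_left mult.commute)
  also have "\<dots> = (\<Sum>j<K. \<Sum>k<K. x $ k * hRe (L $$ (i, j) * hcnj (L $$ (k, j))))"
    by (rule sum.swap)
  also have "\<dots> = (\<Sum>j<K. hRe (L $$ (i, j) * adj_coord x j))"
  proof (rule sum.cong)
    fix j assume "j \<in> {..<K}"
    then show "(\<Sum>k<K. x $ k * hRe (L $$ (i, j) * hcnj (L $$ (k, j)))) =
        hRe (L $$ (i, j) * adj_coord x j)"
      by (simp add: adj_coord_def hRe_mult_sum hRe_mult_scaleR)
  qed simp
  finally show ?thesis .
qed

lemma hmu_adj_coord:
  assumes "i < K"
  shows "hmu (adj_coord x i) = hmu (hcnj (L $$ (i, i))) * x $ i
    + (\<Sum>j\<in>{i<..<K}. hmu (hcnj (L $$ (j, i))) * x $ j)"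
proof -
  have "hmu (adj_coord x i) = (\<Sum>j<K. hmu (hcnj (L $$ (j, i))) * x $ j)"
    by (simp add: adj_coord_def mult.commute)
  also have "\<dots> = hmu (hcnj (L $$ (i, i))) * x $ i + (\<Sum>j\<in>{i<..<K}. hmu (hcnj (L $$ (j, i))) * x $ j)"
    using assms by (intro sum_upper_triangular) (auto simp: L_upper)
  finally show ?thesis .
qed

lemma back_subst_carrier [simp]: "back_subst L y \<in> carrier_vec K"
  by (simp add: back_subst_def)

lemma hmu_adj_coord_back_subst: "i < K \<Longrightarrow> hmu (adj_coord (back_subst L y) i) = hmu (y $ i)"
  using back_subst_equation[OF refl, of i A y] by (simp add: hmu_adj_coord)

text \<open>The \<mu>-components of \<open>L^*\<close> form a real upper triangular matrix with
  nonzero diagonal, so x is determined from the last coordinate upwards.\<close>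

lemma eq_if_hmu_adj_coord_eq:
  assumes "x \<in> carrier_vec K" "x' \<in> carrier_vec K"
    and eq: "\<And>i. i < K \<Longrightarrow> hmu (adj_coord x i) = hmu (adj_coord x' i)"
  shows "x = x'"
proof (rule eq_vecI)
  have "x $ i = x' $ i" if "i < K" for i
    using that
  proof (induction "K - i" arbitrary: i rule: less_induct)
    case less
    have "(\<Sum>j\<in>{i<..<K}. hmu (hcnj (L $$ (j, i))) * x $ j) =
        (\<Sum>j\<in>{i<..<K}. hmu (hcnj (L $$ (j, i))) * x' $ j)"
      using less by (intro sum.cong) auto
    then show ?case
      using eq[OF less.prems] hmu_L_diag[OF less.prems] less.prems by (simp add: hmu_adj_coord)
  qed
  then show "\<And>i. i < dim_vec x' \<Longrightarrow> x $ i = x' $ i" using assms by simp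
qed (use assms in simp)

section \<open>The form of the solutions and the correction on \<open>S\<close>\<close>

lemma solution_form:
  assumes x: "x \<in> carrier_vec K" and Ax: "\<And>i. i < K \<Longrightarrow> i \<notin> S \<Longrightarrow> (A *\<^sub>v x) $ i = b $ i"
  shows "\<exists>\<alpha>\<in>carrier_vec (card S). x = back_subst L (fwd_subst L S b)
    + back_subst_cols L (hom_solutions L S) *\<^sub>v \<alpha>"
proof
  let ?y = "fwd_coord L S b" and ?Y = "hom_coord L S"
  let ?X = "back_subst_cols L (hom_solutions L S)" and ?xt = "back_subst L (fwd_subst L S b)"
  \<comment> \<open>On \<open>S\<close> the \<mu>-components of \<open>?y\<close> are 0 and those of
    \<open>?Y\<close> form the identity, so matching \<open>L^* x\<close> there forces this
    choice.\<close>
  define \<alpha> where "\<alpha> = vec (card S) (\<lambda>q. hmu (adj_coord x (nth_elem S q)))"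
  \<comment> \<open>The gap between \<open>L^* x\<close> and y + Y \<alpha>. It meets the hypotheses
    of \<open>hmu_eq_zero_if_L_mult_zero\<close>, hence its \<mu>-components vanish
    everywhere.\<close>
  define v where "v j = adj_coord x j - ?y j - (\<Sum>k\<in>S. hmu (adj_coord x k) *\<^sub>R ?Y k j)" for j
  have bal: "balanced j (v j)" if "j < K" for j
    using balanced_adj_coord[OF that, of x] balanced_fwd_coord[OF that, of b]
      balanced_hom_coord[OF _ that]
    by (auto simp: v_def balanced_def pure_hemi_def algebra_simps sum_distrib_left intro!: sum.cong)
  have muS: "hmu (v j) = 0" if "j \<in> S" for j
    using that by (simp add: v_def hmu_fwd_coord_S hmu_hom_coord_S if_distrib sum.delta cong: if_cong)
  have Lv: "(\<Sum>j<K. hRe (L $$ (i, j) * v j)) = 0" if "i < K" "i \<notin> S" for i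
  proof -
    have Y: "(\<Sum>j<K. hRe (L $$ (i, j) * ?Y k j)) = 0" if "k \<in> S" for k
      using arg_cong[OF L_mult_hom_coord[OF that \<open>i < K\<close>], of hRe] by simp
    have "(\<Sum>j<K. hRe (L $$ (i, j) * v j)) = (\<Sum>j<K. hRe (L $$ (i, j) * adj_coord x j)
        - hRe (L $$ (i, j) * ?y j) - (\<Sum>k\<in>S. hmu (adj_coord x k) * hRe (L $$ (i, j) * ?Y k j)))"
      using that by (intro sum.cong) (simp_all add: v_def hRe_mult_sum hRe_mult_diff hRe_mult_scaleR)
    also have "\<dots> = (A *\<^sub>v x) $ i - b $ i
        - (\<Sum>j<K. \<Sum>k\<in>S. hmu (adj_coord x k) * hRe (L $$ (i, j) * ?Y k j))"
      using arg_cong[OF L_mult_fwd_coord[OF that(1), of b], of hRe]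
      by (simp add: sum_subtractf A_mult_eq[OF x that(1)])
    also have "\<dots> = 0"
      using Ax[OF that] Y
      by (subst sum.swap) (simp flip: sum_distrib_left)
    finally show ?thesis .
  qed
  have cols: "col ?X q = back_subst L (col (hom_solutions L S) q)" if "q < card S" for q
    using that by (intro eq_vecI) (simp_all add: back_subst_cols_def hom_solutions_def back_subst_def)
  have X: "?X \<in> carrier_mat K (card S)"
    by (simp add: back_subst_cols_def hom_solutions_def)
  \<comment> \<open>The \<mu>-components of \<open>L^* x\<close> are linear in x, and on column q of
    \<open>?X\<close> they return those of column q of the homogeneous solutions;
    \<open>nth_elem\<close> turns the sum over q into one over \<open>S\<close>.\<close>
  have adj_X: "hmu (adj_coord (?X *\<^sub>v \<alpha>) i) = (\<Sum>k\<in>S. hmu (adj_coord x k) * hmu (?Y k i))"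
    if "i < K" for i
  proof -
    have "hmu (adj_coord (?X *\<^sub>v \<alpha>) i)
        = (\<Sum>j<K. \<Sum>q<card S. \<alpha> $ q * (col ?X q $ j * hmu (hcnj (L $$ (j, i)))))"
      using X by (simp add: adj_coord_def scalar_prod_def atLeast0LessThan \<alpha>_def sum_distrib_left
          sum_distrib_right algebra_simps sum_negf)
    also have "\<dots> = (\<Sum>q<card S. \<alpha> $ q * hmu (adj_coord (col ?X q) i))"
      by (subst sum.swap) (simp add: adj_coord_def sum_distrib_left)
    also have "\<dots> = (\<Sum>q<card S. hmu (adj_coord x (nth_elem S q)) * hmu (?Y (nth_elem S q) i))"
    proof (rule sum.cong)
      fix q assume q: "q \<in> {..<card S}"
      then have "col (hom_solutions L S) q $ i = ?Y (nth_elem S q) i"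
        using that by (simp add: hom_solutions_def)
      with that q show "\<alpha> $ q * hmu (adj_coord (col ?X q) i)
          = hmu (adj_coord x (nth_elem S q)) * hmu (?Y (nth_elem S q) i)"
        by (simp add: cols hmu_adj_coord_back_subst \<alpha>_def)
    qed simp
    also have "\<dots> = (\<Sum>k\<in>S. hmu (adj_coord x k) * hmu (?Y k i))"
      using bij_betw_nth_elem[OF finite_S] by (rule sum.reindex_bij_betw)
    finally show ?thesis .
  qed
  show "x = ?xt + ?X *\<^sub>v \<alpha>"
  proof (rule eq_if_hmu_adj_coord_eq)
    show "?xt + ?X *\<^sub>v \<alpha> \<in> carrier_vec K"
      using mult_mat_vec_carrier[OF X, of \<alpha>] by (simp add: \<alpha>_def)
    fix i assume i: "i < K"
    have "hmu (adj_coord (?xt + ?X *\<^sub>v \<alpha>) i) = hmu (adj_coord ?xt i) + hmu (adj_coord (?X *\<^sub>v \<alpha>) i)"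
      using X by (simp add: adj_coord_def sum.distrib algebra_simps sum_negf)
    also have "\<dots> = hmu (?y i) + (\<Sum>k\<in>S. hmu (adj_coord x k) * hmu (?Y k i))"
      using i by (simp add: hmu_adj_coord_back_subst adj_X fwd_subst_def)
    also have "\<dots> = hmu (adj_coord x i)"
      using hmu_eq_zero_if_L_mult_zero[OF bal muS Lv i] by (simp add: v_def)
    finally show "hmu (adj_coord x i) = hmu (adj_coord (?xt + ?X *\<^sub>v \<alpha>) i)" by simp
  qed (rule x)
qed simp

text \<open>Backward substitution matches only \<mu>-components. Off \<open>S\<close> balance then
  forces the \<nu>-components to match too; at j in \<open>S\<close> they may differ, but this is
  invisible in row i, since \<open>L $$ (i, j)\<close> has no \<mu>-component for i \<noteq>
  j.\<close>

lemma back_subst_solves_off_S: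
  assumes "i < K" "i \<notin> S"
  shows "(A *\<^sub>v back_subst L (fwd_subst L S b)) $ i = b $ i"
proof -
  let ?y = "fwd_coord L S b" and ?xt = "back_subst L (fwd_subst L S b)"
  have "hRe (L $$ (i, j) * adj_coord ?xt j) = hRe (L $$ (i, j) * ?y j)" if "j < K" for j
  proof -
    have mu: "hmu (adj_coord ?xt j) = hmu (?y j)"
      using that by (simp add: hmu_adj_coord_back_subst fwd_subst_def)
    have bal: "balanced j (adj_coord ?xt j)" "balanced j (?y j)"
      using that by (auto intro: balanced_adj_coord balanced_fwd_coord)
    show ?thesis
    proof (cases "j \<in> S")
      case True
      then show ?thesis
        using assms that bal mu hmu_L_S[of j i] by (auto simp: hRe_mult balanced_def pure_hemi_def)
    next
      case False
      then show ?thesis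
        using bal mu by (simp add: hRe_mult balanced_def pure_hemi_def)
    qed
  qed
  then have "(A *\<^sub>v ?xt) $ i = (\<Sum>j<K. hRe (L $$ (i, j) * ?y j))"
    by (simp add: A_mult_eq[OF back_subst_carrier assms(1)])
  also have "\<dots> = b $ i"
    using arg_cong[OF L_mult_fwd_coord[OF assms(1), of b], of hRe] by simp
  finally show ?thesis .
qed

lemma ex_correction:
  assumes b: "b \<in> carrier_vec K"
  defines "xt \<equiv> back_subst L (fwd_subst L S b)"
  shows "\<exists>\<Delta>b\<in>carrier_vec K. (\<forall>i<K. i \<notin> S \<longrightarrow> \<Delta>b $ i = 0) \<and>
    ((\<exists>x\<in>carrier_vec K. A *\<^sub>v x = b) \<longrightarrow> \<Delta>b = 0\<^sub>v K) \<and>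
    (\<exists>x\<in>carrier_vec K. A *\<^sub>v x = b + \<Delta>b)"
proof (cases "\<exists>x\<in>carrier_vec K. A *\<^sub>v x = b")
  case True
  with b show ?thesis by (intro bexI[of _ "0\<^sub>v K"]) auto
next
  case False
  have xt: "xt \<in> carrier_vec K"
    by (simp add: xt_def)
  \<comment> \<open>The residual of \<open>xt\<close> serves as correction, with \<open>xt\<close>
    itself as a solution.\<close>
  have "A *\<^sub>v xt = b + (A *\<^sub>v xt - b)"
    using b carrier xt by (intro eq_vecI) auto
  with xt have "\<exists>x\<in>carrier_vec K. A *\<^sub>v x = b + (A *\<^sub>v xt - b)" ..
  moreover have "\<forall>i<K. i \<notin> S \<longrightarrow> (A *\<^sub>v xt - b) $ i = 0"
    using b back_subst_solves_off_S[of _ b] by (auto simp: xt_def)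
  moreover have "A *\<^sub>v xt - b \<in> carrier_vec K"
    using b carrier xt by simp
  ultimately show ?thesis
    using False by blast
qed

end

theorem theorem5p1:
  fixes A :: "real mat" and b :: "real vec" and K :: nat
    and L Y :: "hemiplex mat" and y :: "hemiplex vec" and S :: "nat set"
    and xt :: "real vec" and X :: "real mat"
  assumes "A \<in> carrier_mat K K" and "transpose_mat A = A" and "b \<in> carrier_vec K"
    and "L = hemi_cholesky A" and "S = zero_pivots A"
    and "y = fwd_subst L S b" and "Y = hom_solutions L S"
    and "xt = back_subst L y" and "X = back_subst_cols L Y"
  shows "map_mat hemi_of_real A = hmat_mult L (hmat_adjoint L) \<and>
    hmat_mult_vec L y = map_vec hemi_of_real b \<and>
    (\<forall>i<K. \<forall>q<card S. pure_hemi (Y $$ (i, q))) \<and>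
    hmat_mult L Y = 0\<^sub>m K (card S) \<and>
    (\<forall>p<card S. \<forall>q<card S. hmu (Y $$ (nth_elem S p, q)) = (if p = q then 1 else 0)) \<and>
    (\<exists>\<Delta>b\<in>carrier_vec K.
           (\<forall>i<K. i \<notin> S \<longrightarrow> \<Delta>b $ i = 0) \<and>
           ((\<exists>x\<in>carrier_vec K. A *\<^sub>v x = b) \<longrightarrow> \<Delta>b = 0\<^sub>v K) \<and>
           (\<exists>x\<in>carrier_vec K. A *\<^sub>v x = b + \<Delta>b) \<and>
           (\<forall>x\<in>carrier_vec K. A *\<^sub>v x = b + \<Delta>b \<longrightarrow>
              (\<exists>\<alpha>\<in>carrier_vec (card S). x = xt + X *\<^sub>v \<alpha>)))"
proof -
  interpret cholesky A K
    using assms(1,2) by unfold_locales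
  have nth: "nth_elem S q \<in> S" if "q < card S" for q
    using bij_betwE[OF bij_betw_nth_elem] finite_S assms(5) that by auto
  have Ly: "hmat_mult_vec L y = map_vec hemi_of_real b"
    unfolding assms(4-6) using assms(3) L_mult_fwd_coord[of _ b]
    by (intro eq_vecI) (auto simp: hmat_mult_vec_def fwd_subst_def)
  have pure: "pure_hemi (Y $$ (i, q))" if "i < K" "q < card S" for i q
    using that nth[of q] balanced_hom_coord[of "nth_elem S q" i]
    by (simp add: assms(4,5,7) hom_solutions_def balanced_def)
  have LY: "hmat_mult L Y = 0\<^sub>m K (card S)"
    using nth L_mult_hom_coord unfolding assms(4,5,7)
    by (intro eq_matI) (auto simp: hmat_mult_def hom_solutions_def)
  have delta: "hmu (Y $$ (nth_elem S p, q)) = (if p = q then 1 else 0)"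
    if "p < card S" "q < card S" for p q
  proof -
    have "nth_elem S p = nth_elem S q \<longleftrightarrow> p = q"
      using that bij_betw_imp_inj_on[OF bij_betw_nth_elem[of S]] finite_S
      by (auto simp: assms(5) inj_on_def)
    then show ?thesis
      using that nth[of p] S_lt[of "nth_elem S p"]
      by (simp add: assms(4,5,7) hom_solutions_def hmu_hom_coord_S)
  qed
  obtain \<Delta>b where \<Delta>b: "\<Delta>b \<in> carrier_vec K" "\<forall>i<K. i \<notin> S \<longrightarrow> \<Delta>b $ i = 0"
    "(\<exists>x\<in>carrier_vec K. A *\<^sub>v x = b) \<longrightarrow> \<Delta>b = 0\<^sub>v K"
    "\<exists>x\<in>carrier_vec K. A *\<^sub>v x = b + \<Delta>b"
    using ex_correction[OF assms(3)] unfolding assms(5) by blast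
  have sol: "\<exists>\<alpha>\<in>carrier_vec (card S). x = xt + X *\<^sub>v \<alpha>"
    if "x \<in> carrier_vec K" "A *\<^sub>v x = b + \<Delta>b" for x
    unfolding assms(4-9)
  proof (rule solution_form[OF that(1)])
    \<comment> \<open>The correction vanishes off \<open>S\<close>, and \<open>solution_form\<close>
      asks for agreement with b only there.\<close>
    show "(A *\<^sub>v x) $ i = b $ i" if "i < K" "i \<notin> zero_pivots A" for i
      using that \<Delta>b(1,2) assms(3,5) \<open>A *\<^sub>v x = b + \<Delta>b\<close> by auto
  qed
  have "map_mat hemi_of_real A = hmat_mult L (hmat_adjoint L)"
    unfolding assms(4) by (rule factorization)
  then show ?thesis
    by (intro conjI, use Ly pure LY delta in simp_all)
      (rule bexI[OF _ \<Delta>b(1)], intro conjI \<Delta>b(2-4), use sol in blast)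
qed

end
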